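(* Let $G_1$ and $G_2$ be two finite simple graphs on $n_1$ and $n_2$ vertices and with $m_1$ and $m_2$ edges, respectively. For $i=1,2$ let $\Delta_i$ and $\delta_i$ denote the maximum and minimum vertex degree of $G_i$, and let $\overline{m}$ be the number of edges of $\overline{G_1\square G_2}$. Then $$\sqrt{2}\,\overline{m}\,(\delta_1+\delta_2)\leq \overline{SO}(G_1\square G_2)\leq \sqrt{2}\,\overline{m}\,(\Delta_1+\Delta_2).$$ Moreover, equality holds (in both inequalities) if $G_1$ and $G_2$ are regular.
   Context: All graphs are finite and simple, with nonempty vertex set. The Cartesian product $G_1\square G_2$ is the graph with vertex set $V(G_1)\times V(G_2)$ in which $(u_1,u_2)$ is adjacent to $(v_1,v_2)$ whenever ($u_1=v_1$ and $u_2v_2\in E(G_2)$) or ($u_2=v_2$ and $u_1v_1\in E(G_1)$). $d_G(u)$ denotes the degree of $u$ in $G$, and $\overline{G}$ is the complement of $G$. The Sombor coindex of $G$ is $$\overline{SO}(G)=\sum_{uv\in E(\overline{G})}\sqrt{d_G(u)^2+d_G(v)^2},$$ the sum being over unordered pairs of distinct non-adjacent vertices of $G$, with degrees taken in $G$. *)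

theory Defs
  imports Complex_Main
begin

text \<open>Undirected graphs, with edges as unordered pairs, i.e. two-element sets of vertices.\<close>

record 'a ugraph =
  verts :: "'a set"
  edges :: "'a set set"

definition simple_graph :: "'a ugraph \<Rightarrow> bool" where
  "simple_graph G \<longleftrightarrow>
     finite (verts G) \<and> verts G \<noteq> {} \<and> (\<forall>e\<in>edges G. e \<subseteq> verts G \<and> card e = 2)"

definition deg :: "'a ugraph \<Rightarrow> 'a \<Rightarrow> nat" where
  "deg G u = card {e \<in> edges G. u \<in> e}"

definition max_deg :: "'a ugraph \<Rightarrow> nat" where
  "max_deg G = Max (deg G ` verts G)"

definition min_deg :: "'a ugraph \<Rightarrow> nat" where
  "min_deg G = Min (deg G ` verts G)"

definition regular_graph :: "'a ugraph \<Rightarrow> bool" where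
  "regular_graph G \<longleftrightarrow> (\<exists>k. \<forall>u\<in>verts G. deg G u = k)"

definition complement_graph :: "'a ugraph \<Rightarrow> 'a ugraph" where
  "complement_graph G =
     \<lparr> verts = verts G,
       edges = {{u, v} | u v. u \<in> verts G \<and> v \<in> verts G \<and> u \<noteq> v \<and> {u, v} \<notin> edges G} \<rparr>"

definition cartesian_product :: "'a ugraph \<Rightarrow> 'b ugraph \<Rightarrow> ('a \<times> 'b) ugraph" where
  "cartesian_product G H =
     \<lparr> verts = verts G \<times> verts H,
       edges = {{(u1, u2), (v1, v2)} | u1 u2 v1 v2.
                  (u1, u2) \<in> verts G \<times> verts H \<and> (v1, v2) \<in> verts G \<times> verts H \<and>
                  (u1 = v1 \<and> {u2, v2} \<in> edges H \<or> u2 = v2 \<and> {u1, v1} \<in> edges G)} \<rparr>"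

text \<open>
  The contribution of an edge \<open>{u, v}\<close> of the complement is the square root of
  the sum of the squares of the degrees of \<open>u\<close> and \<open>v\<close> in \<open>G\<close> itself, not in
  the complement; writing it as a sum over the two elements of the edge makes it
  independent of an orientation (see \<open>sombor_weight_pair\<close> below).
\<close>

definition sombor_weight :: "'a ugraph \<Rightarrow> 'a set \<Rightarrow> real" where
  "sombor_weight G e = sqrt (\<Sum>w\<in>e. (real (deg G w))\<^sup>2)"

definition sombor_coindex :: "'a ugraph \<Rightarrow> real" where
  "sombor_coindex G = (\<Sum>e\<in>edges (complement_graph G). sombor_weight G e)"

lemma sombor_weight_pair:
  "u \<noteq> v \<Longrightarrow> sombor_weight G {u, v} = sqrt ((real (deg G u))\<^sup>2 + (real (deg G v))\<^sup>2)"
  by (simp add: sombor_weight_def)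

lemma simple_graph_complement_graph:
  "simple_graph G \<Longrightarrow> simple_graph (complement_graph G)"
  by (auto simp: simple_graph_def complement_graph_def)

lemma simple_graph_cartesian_product:
  assumes "simple_graph G" "simple_graph H"
  shows "simple_graph (cartesian_product G H)"
proof -
  have G: "u \<noteq> v" if "{u, v} \<in> edges G" for u v
    using assms(1) that by (force simp: simple_graph_def)
  have H: "u \<noteq> v" if "{u, v} \<in> edges H" for u v
    using assms(2) that by (force simp: simple_graph_def)
  show ?thesis
    using assms by (auto simp: simple_graph_def cartesian_product_def card_insert_if dest: G H)
qed

end

theory Submission
  imports Defs
begin

text \<open>
  The argument is a termwise estimate. If every vertex of a graph has its degree between \<open>d\<close> and
  \<open>D\<close>, then each non-adjacent pair contributes between \<open>sqrt (d\<^sup>2 + d\<^sup>2) = sqrt 2 * d\<close> and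
  \<open>sqrt 2 * D\<close> to the Sombor coindex, so summing over the edges of the complement bounds the coindex
  (\<open>sombor_coindex_ge\<close> and \<open>sombor_coindex_le\<close>). In a Cartesian product, the edges at \<open>(a, b)\<close> are
  the copies of the edges at \<open>a\<close> in the layer of \<open>b\<close> and the copies of the edges at \<open>b\<close> in the
  layer of \<open>a\<close>, so degrees add up (\<open>deg_cartesian_product\<close>), and \<open>d\<close> and \<open>D\<close> can be taken to be
  \<open>\<delta>1 + \<delta>2\<close> and \<open>\<Delta>1 + \<Delta>2\<close>. For regular factors these two numbers agree, hence so do the two
  bounds, and the coindex is squeezed between them.
\<close>

lemma simple_graph_finite_edges:
  assumes "simple_graph G"
  shows "finite (edges G)"
proof (rule finite_subset)
  show "edges G \<subseteq> Pow (verts G)" and "finite (Pow (verts G))"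
    using assms by (auto simp: simple_graph_def)
qed

lemma simple_graph_edgeE:
  assumes "simple_graph G" and "e \<in> edges G"
  obtains u v where "e = {u, v}" "u \<noteq> v" "u \<in> verts G" "v \<in> verts G"
proof -
  have "card e = 2" and "e \<subseteq> verts G"
    using assms by (auto simp: simple_graph_def)
  then show thesis
    using that by (auto simp: card_2_iff)
qed

text \<open>
  Writing an edge of the product as a rectangle \<open>e \<times> {b}\<close> or \<open>{a} \<times> f\<close> makes the copies of an edge
  visible as injective images, which is what the degree count needs.
\<close>

lemma edges_cartesian_product:
  assumes G: "simple_graph G" and H: "simple_graph H"
  shows "edges (cartesian_product G H) =
    {e \<times> {b} | e b. e \<in> edges G \<and> b \<in> verts H} \<union> {{a} \<times> f | a f. a \<in> verts G \<and> f \<in> edges H}"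
    (is "_ = ?L \<union> ?R")
proof (intro equalityI subsetI)
  fix x assume "x \<in> edges (cartesian_product G H)"
  then obtain u1 u2 v1 v2 where x: "x = {(u1, u2), (v1, v2)}"
    and V: "u1 \<in> verts G" "u2 \<in> verts H"
    and "u1 = v1 \<and> {u2, v2} \<in> edges H \<or> u2 = v2 \<and> {u1, v1} \<in> edges G"
    by (auto simp: cartesian_product_def)
  then consider "u1 = v1" "{u2, v2} \<in> edges H" | "u2 = v2" "{u1, v1} \<in> edges G"
    by blast
  then show "x \<in> ?L \<union> ?R"
  proof cases
    case 1
    moreover from this x have "x = {u1} \<times> {u2, v2}" by auto
    ultimately show ?thesis using V by blast
  next
    case 2
    moreover from this x have "x = {u1, v1} \<times> {u2}" by auto
    ultimately show ?thesis using V by blast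
  qed
next
  fix x assume "x \<in> ?L \<union> ?R"
  then consider e b where "x = e \<times> {b}" "e \<in> edges G" "b \<in> verts H"
    | a f where "x = {a} \<times> f" "a \<in> verts G" "f \<in> edges H"
    by blast
  then show "x \<in> edges (cartesian_product G H)"
  proof cases
    case 1
    from G 1(2) obtain u v where e: "e = {u, v}" "u \<in> verts G" "v \<in> verts G"
      by (rule simple_graph_edgeE)
    with 1 have "x = {(u, b), (v, b)}" by auto
    with 1 e show ?thesis by (fastforce simp: cartesian_product_def)
  next
    case 2
    from H 2(3) obtain u v where f: "f = {u, v}" "u \<in> verts H" "v \<in> verts H"
      by (rule simple_graph_edgeE)
    with 2 have "x = {(a, u), (a, v)}" by auto
    with 2 f show ?thesis by (fastforce simp: cartesian_product_def)
  qed
qed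

text \<open>
  No edge is counted twice: a rectangle that is both \<open>e \<times> {b}\<close> and \<open>{a} \<times> f\<close> would be a single
  point, whereas edges have two elements.
\<close>

lemma deg_cartesian_product:
  assumes G: "simple_graph G" and H: "simple_graph H"
    and a: "a \<in> verts G" and b: "b \<in> verts H"
  shows "deg (cartesian_product G H) (a, b) = deg G a + deg H b"
proof -
  let ?A = "{e \<in> edges G. a \<in> e}" and ?B = "{f \<in> edges H. b \<in> f}"
  let ?g = "\<lambda>e. e \<times> {b}" and ?h = "\<lambda>f. {a} \<times> f"
  have incident: "{x \<in> edges (cartesian_product G H). (a, b) \<in> x} = ?g ` ?A \<union> ?h ` ?B"
    unfolding edges_cartesian_product[OF G H] using a b by auto
  have "?g ` ?A \<inter> ?h ` ?B = {}"
  proof (rule ccontr)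
    assume "?g ` ?A \<inter> ?h ` ?B \<noteq> {}"
    then obtain e f where e: "e \<in> edges G" and "b \<in> f" and eq: "e \<times> {b} = {a} \<times> f"
      by blast
    then have "e \<subseteq> {a}" by blast
    then have "card e \<le> 1" using card_mono[of "{a}" e] by simp
    with G e show False by (auto simp: simple_graph_def)
  qed
  moreover have "finite ?A" "finite ?B"
    using G H by (auto dest: simple_graph_finite_edges)
  moreover have "inj_on ?g ?A" "inj_on ?h ?B"
    by (auto simp: inj_on_def)
  ultimately show ?thesis
    unfolding deg_def incident by (simp add: card_Un_disjoint card_image)
qed

lemma sqrt_sum_same_squares:
  fixes c :: real
  assumes "0 \<le> c"
  shows "sqrt (c\<^sup>2 + c\<^sup>2) = sqrt 2 * c"
proof -
  have "c\<^sup>2 + c\<^sup>2 = 2 * c\<^sup>2" by simp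
  then show ?thesis using assms by (simp only: real_sqrt_mult real_sqrt_abs abs_of_nonneg)
qed

lemma sombor_coindex_ge:
  assumes "\<And>w. w \<in> verts G \<Longrightarrow> d \<le> deg G w"
  shows "sqrt 2 * real (card (edges (complement_graph G))) * real d \<le> sombor_coindex G"
proof -
  have "sqrt 2 * real d \<le> sombor_weight G e" if "e \<in> edges (complement_graph G)" for e
  proof -
    from that obtain u v where e: "e = {u, v}" "u \<noteq> v" and V: "u \<in> verts G" "v \<in> verts G"
      by (auto simp: complement_graph_def)
    have "sqrt 2 * real d = sqrt ((real d)\<^sup>2 + (real d)\<^sup>2)"
      by (rule sqrt_sum_same_squares[symmetric]) simp
    also have "\<dots> \<le> sombor_weight G e"
      using V assms unfolding e(1) sombor_weight_pair[OF e(2)]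
      by (intro real_sqrt_le_mono add_mono power_mono) simp_all
    finally show ?thesis .
  qed
  then show ?thesis
    unfolding sombor_coindex_def
    using sum_bounded_below[of "edges (complement_graph G)" "sqrt 2 * real d" "sombor_weight G"]
    by (simp add: mult_ac)
qed

lemma sombor_coindex_le:
  assumes "\<And>w. w \<in> verts G \<Longrightarrow> deg G w \<le> D"
  shows "sombor_coindex G \<le> sqrt 2 * real (card (edges (complement_graph G))) * real D"
proof -
  have "sombor_weight G e \<le> sqrt 2 * real D" if "e \<in> edges (complement_graph G)" for e
  proof -
    from that obtain u v where e: "e = {u, v}" "u \<noteq> v" and V: "u \<in> verts G" "v \<in> verts G"
      by (auto simp: complement_graph_def)
    have "sombor_weight G e \<le> sqrt ((real D)\<^sup>2 + (real D)\<^sup>2)"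
      using V assms unfolding e(1) sombor_weight_pair[OF e(2)]
      by (intro real_sqrt_le_mono add_mono power_mono) simp_all
    also have "\<dots> = sqrt 2 * real D"
      by (rule sqrt_sum_same_squares) simp
    finally show ?thesis .
  qed
  then show ?thesis
    unfolding sombor_coindex_def
    using sum_bounded_above[of "edges (complement_graph G)" "sombor_weight G" "sqrt 2 * real D"]
    by (simp add: mult_ac)
qed

lemma min_deg_le:
  assumes "simple_graph G" and "u \<in> verts G"
  shows "min_deg G \<le> deg G u"
  using assms by (auto simp: simple_graph_def min_deg_def)

lemma le_max_deg:
  assumes "simple_graph G" and "u \<in> verts G"
  shows "deg G u \<le> max_deg G"
  using assms by (auto simp: simple_graph_def max_deg_def)

lemma regular_graph_min_deg_eq_max_deg:
  assumes "simple_graph G" and "regular_graph G"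
  shows "min_deg G = max_deg G"
proof -
  from assms(2) obtain k where "\<forall>u\<in>verts G. deg G u = k"
    by (auto simp: regular_graph_def)
  moreover have "verts G \<noteq> {}"
    using assms(1) by (simp add: simple_graph_def)
  ultimately have "deg G ` verts G = {k}" by force
  then show ?thesis by (simp add: min_deg_def max_deg_def)
qed

theorem theorem5p5:
  fixes G1 :: "'a ugraph" and G2 :: "'b ugraph"
    and n1 n2 m1 m2 \<Delta>1 \<Delta>2 \<delta>1 \<delta>2 mbar :: nat
  assumes "simple_graph G1" and "simple_graph G2"
    and "card (verts G1) = n1" and "card (verts G2) = n2"
    and "card (edges G1) = m1" and "card (edges G2) = m2"
    and "\<Delta>1 = max_deg G1" and "\<Delta>2 = max_deg G2"
    and "\<delta>1 = min_deg G1" and "\<delta>2 = min_deg G2"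
    and "mbar = card (edges (complement_graph (cartesian_product G1 G2)))"
  shows "(sqrt 2 * real mbar * (real \<delta>1 + real \<delta>2) \<le> sombor_coindex (cartesian_product G1 G2)
          \<and> sombor_coindex (cartesian_product G1 G2) \<le> sqrt 2 * real mbar * (real \<Delta>1 + real \<Delta>2))
       \<and> (regular_graph G1 \<and> regular_graph G2 \<longrightarrow>
            sqrt 2 * real mbar * (real \<delta>1 + real \<delta>2) = sombor_coindex (cartesian_product G1 G2)
          \<and> sombor_coindex (cartesian_product G1 G2) = sqrt 2 * real mbar * (real \<Delta>1 + real \<Delta>2))"
proof -
  let ?P = "cartesian_product G1 G2"
  have deg_bounds: "\<delta>1 + \<delta>2 \<le> deg ?P w \<and> deg ?P w \<le> \<Delta>1 + \<Delta>2" if "w \<in> verts ?P" for w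
  proof -
    from that obtain a b where w: "w = (a, b)" and a: "a \<in> verts G1" and b: "b \<in> verts G2"
      by (auto simp: cartesian_product_def)
    then have "deg ?P w = deg G1 a + deg G2 b"
      using assms(1,2) by (simp add: deg_cartesian_product)
    then show ?thesis
      using assms(1,2,7-10) a b by (simp add: add_mono min_deg_le le_max_deg)
  qed
  have lower: "sqrt 2 * real mbar * (real \<delta>1 + real \<delta>2) \<le> sombor_coindex ?P"
    using sombor_coindex_ge[of ?P "\<delta>1 + \<delta>2"] deg_bounds assms(11) by simp
  have upper: "sombor_coindex ?P \<le> sqrt 2 * real mbar * (real \<Delta>1 + real \<Delta>2)"
    using sombor_coindex_le[of ?P "\<Delta>1 + \<Delta>2"] deg_bounds assms(11) by simp
  have "\<delta>1 = \<Delta>1 \<and> \<delta>2 = \<Delta>2" if "regular_graph G1 \<and> regular_graph G2"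
    using that assms(1,2,7-10) by (simp add: regular_graph_min_deg_eq_max_deg)
  with lower upper show ?thesis by auto
qed

end
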